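(* Let $X$ be a locally indiscrete space. The following conditions are equivalent: (a) $X$ is a $T_1$-space. (b) $X$ is a $T_{\frac12}$-space. (c) $X$ is a $T_D$-space. (d) $X$ is a $T_0$-space. (e) $X$ is a submaximal space. (f) $X$ is a discrete space.
   Context: A space is locally indiscrete if every open set is closed (equivalently, every closed set is open). A space is a $T_{\frac12}$-space if every singleton is either open or closed. A subset $A$ of $X$ is locally closed if for every $x\in A$ there is an open set $U\subseteq X$ such that $x\in U$ and $A\cap U$ is closed in $U$ (equivalently, $A$ is the intersection of an open set and a closed set); a space is a $T_D$-space if every singleton is locally closed. A space is submaximal if every dense subset is open. *)

theory Defs
  imports "HOL-Analysis.Analysis"
begin

definition locally_indiscrete_space :: "'a topology \<Rightarrow> bool" where
  "locally_indiscrete_space X \<longleftrightarrow> (\<forall>U. openin X U \<longrightarrow> closedin X U)"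

definition t_half_space :: "'a topology \<Rightarrow> bool" where
  "t_half_space X \<longleftrightarrow> (\<forall>x \<in> topspace X. openin X {x} \<or> closedin X {x})"

definition locally_closedin :: "'a topology \<Rightarrow> 'a set \<Rightarrow> bool" where
  "locally_closedin X A \<longleftrightarrow> A \<subseteq> topspace X \<and>
     (\<forall>x \<in> A. \<exists>U. openin X U \<and> x \<in> U \<and> closedin (subtopology X U) (A \<inter> U))"

definition td_space :: "'a topology \<Rightarrow> bool" where
  "td_space X \<longleftrightarrow> (\<forall>x \<in> topspace X. locally_closedin X {x})"

definition submaximal_space :: "'a topology \<Rightarrow> bool" where
  "submaximal_space X \<longleftrightarrow>
     (\<forall>D. D \<subseteq> topspace X \<and> X closure_of D = topspace X \<longrightarrow> openin X D)"

definition discrete_space :: "'a topology \<Rightarrow> bool" where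
  "discrete_space X \<longleftrightarrow> X = discrete_topology (topspace X)"

end

theory Submission
  imports Defs
begin

text \<open>
  In a locally indiscrete space complementation turns the hypothesis into its dual, so open and
  closed sets coincide. Each of the six conditions is equivalent to all singletons being
  open, that is, to discreteness. A discrete space trivially satisfies the others. Conversely, the
  conditions T1, T1/2 and TD each make every singleton closed (for TD because a relatively closed
  subset of an open, hence closed, set is closed), hence open. For T0 and submaximality the
  argument runs through the closure of a point, which is clopen: its points cannot be separated
  from each other by open sets, so T0 shrinks it to a singleton
  (\<open>t0_locally_indiscrete_imp_openin_singleton\<close>); and removing from the space all points of
  the closure but \<open>x\<close> itself leaves a dense set, so submaximality isolates \<open>x\<close>
  (\<open>submaximal_locally_indiscrete_imp_openin_singleton\<close>).
\<close>

lemma openin_iff_closedin_if_locally_indiscrete: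
  assumes "locally_indiscrete_space X"
  shows "openin X S \<longleftrightarrow> closedin X S"
proof
  assume "closedin X S"
  then have "openin X (topspace X - S)" and "S \<subseteq> topspace X"
    by (auto simp: closedin_def)
  then show "openin X S"
    using assms by (simp add: locally_indiscrete_space_def openin_closedin_eq)
qed (use assms in \<open>simp add: locally_indiscrete_space_def\<close>)

lemma discrete_space_iff_openin_singleton:
  "discrete_space X \<longleftrightarrow> (\<forall>x \<in> topspace X. openin X {x})"
  using discrete_topology_unique[of "topspace X" X] by (auto simp: discrete_space_def)

lemma discrete_space_iff_openin_subsets:
  "discrete_space X \<longleftrightarrow> (\<forall>S \<subseteq> topspace X. openin X S)"
proof
  assume "discrete_space X"
  then have "openin X = openin (discrete_topology (topspace X))"
    unfolding discrete_space_def by (rule arg_cong)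
  then show "\<forall>S \<subseteq> topspace X. openin X S" by simp
qed (simp add: discrete_space_iff_openin_singleton)

lemma td_locally_indiscrete_imp_closedin_singleton:
  assumes "locally_indiscrete_space X" "td_space X" "x \<in> topspace X"
  shows "closedin X {x}"
proof -
  obtain U where U: "openin X U" "x \<in> U" "closedin (subtopology X U) ({x} \<inter> U)"
    using assms(2,3) by (auto simp: td_space_def locally_closedin_def)
  have "closedin X U"
    using assms(1) U(1) by (simp add: locally_indiscrete_space_def)
  then have "closedin X ({x} \<inter> U)"
    using U(3) closedin_trans_full by blast
  with U(2) show ?thesis by simp
qed

text \<open>An open set separating \<open>x\<close> from a point \<open>y\<close> of its closure would be closed, and so would its
  complement; whichever of the two contains \<open>x\<close> would contain the whole closure of \<open>x\<close>.\<close>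

lemma t0_locally_indiscrete_imp_openin_singleton:
  assumes "locally_indiscrete_space X" "t0_space X" "x \<in> topspace X"
  shows "openin X {x}"
proof -
  let ?C = "X closure_of {x}"
  have "y = x" if "y \<in> ?C" for y
  proof (rule ccontr)
    assume "y \<noteq> x"
    moreover have y: "y \<in> topspace X"
      using that by (simp add: in_closure_of)
    ultimately obtain U where U: "openin X U" "(x \<notin> U) = (y \<in> U)"
      using assms(2,3) unfolding t0_space_def by metis
    have "closedin X U" "closedin X (topspace X - U)"
      using assms(1) U(1) by (auto simp: locally_indiscrete_space_def)
    then have "x \<in> U \<Longrightarrow> ?C \<subseteq> U" and "x \<notin> U \<Longrightarrow> ?C \<subseteq> topspace X - U"
      using assms(3) by (simp_all add: closure_of_minimal)
    with that U(2) show False by blast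
  qed
  moreover have "x \<in> ?C"
    using assms(3) closure_of_subset[of "{x}" X] by simp
  ultimately have "?C = {x}" by blast
  then have "closedin X {x}" using closedin_closure_of[of X "{x}"] by simp
  then show ?thesis
    by (simp add: openin_iff_closedin_if_locally_indiscrete[OF assms(1)])
qed

lemma submaximal_locally_indiscrete_imp_openin_singleton:
  assumes "locally_indiscrete_space X" "submaximal_space X" "x \<in> topspace X"
  shows "openin X {x}"
proof -
  let ?C = "X closure_of {x}"
  \<comment> \<open>This set is dense because \<open>x\<close> alone already recovers all of its closure.\<close>
  let ?D = "(topspace X - ?C) \<union> {x}"
  have D: "?D \<subseteq> topspace X" using assms(3) by blast
  have "?C \<subseteq> X closure_of ?D" by (rule closure_of_mono) blast
  moreover have "?D \<subseteq> X closure_of ?D" by (rule closure_of_subset[OF D])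
  ultimately have "X closure_of ?D = topspace X"
    using closure_of_subset_topspace[of X ?D] by blast
  then have "openin X ?D"
    using assms(2) D by (auto simp: submaximal_space_def)
  moreover have "openin X ?C"
    by (simp add: openin_iff_closedin_if_locally_indiscrete[OF assms(1)])
  ultimately have "openin X (?D \<inter> ?C)" by blast
  moreover have "?D \<inter> ?C = {x}"
    using assms(3) closure_of_subset[of "{x}" X] by auto
  ultimately show ?thesis by simp
qed

theorem proposition3p5:
  fixes X :: "'a topology"
  assumes "locally_indiscrete_space X"
  shows "(t1_space X \<longleftrightarrow> t_half_space X) \<and>
         (t_half_space X \<longleftrightarrow> td_space X) \<and>
         (td_space X \<longleftrightarrow> t0_space X) \<and>
         (t0_space X \<longleftrightarrow> submaximal_space X) \<and>
         (submaximal_space X \<longleftrightarrow> discrete_space X)"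
proof -
  note open_iff_closed = openin_iff_closedin_if_locally_indiscrete[OF assms]
  have t1: "t1_space X \<longleftrightarrow> discrete_space X"
    by (simp add: t1_space_closedin_singleton discrete_space_iff_openin_singleton open_iff_closed)
  have t_half: "t_half_space X \<longleftrightarrow> discrete_space X"
    by (simp add: t_half_space_def discrete_space_iff_openin_singleton open_iff_closed)
  have td: "td_space X \<longleftrightarrow> discrete_space X"
  proof
    assume "td_space X"
    then show "discrete_space X"
      using td_locally_indiscrete_imp_closedin_singleton[OF assms]
      by (simp add: discrete_space_iff_openin_singleton open_iff_closed)
  next
    assume "discrete_space X"
    then have "closedin X {x}" if "x \<in> topspace X" for x
      using that by (simp add: discrete_space_iff_openin_singleton open_iff_closed)
    then have "closedin (subtopology X (topspace X)) ({x} \<inter> topspace X)"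
      if "x \<in> topspace X" for x
      using that by simp
    then show "td_space X"
      unfolding td_space_def locally_closedin_def by blast
  qed
  have t0: "t0_space X \<longleftrightarrow> discrete_space X"
    using t0_locally_indiscrete_imp_openin_singleton[OF assms] t1 t1_imp_t0_space
    by (auto simp: discrete_space_iff_openin_singleton)
  have submaximal: "submaximal_space X \<longleftrightarrow> discrete_space X"
  proof
    assume "submaximal_space X"
    then show "discrete_space X"
      using submaximal_locally_indiscrete_imp_openin_singleton[OF assms]
      by (simp add: discrete_space_iff_openin_singleton)
  next
    assume "discrete_space X"
    then show "submaximal_space X"
      by (simp add: discrete_space_iff_openin_subsets submaximal_space_def)
  qed
  show ?thesis
    using t1 t_half td t0 submaximal by blast
qed

end
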